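(* (Fully discrete conservation of momentum.) Suppose that the data at the times $t^{\tau}$ and $t^{\tau+1}=t^{\tau}+\Delta t$ are related by the Crank-Nicolson Legendre-Fourier scheme: for $s\in\{e,i\}$, $0\le n\le N_L-1$, $-N_F\le k\le N_F$, $$\frac{C^{s,\tau+1}_{n,k}-C^{s,\tau}_{n,k}}{\Delta t}+\frac{\pi i}{L}k\Big(\sigma_{n+1}\widehat C^s_{n+1,k}+\sigma_n\widehat C^s_{n-1,k}+\overline\sigma\widehat C^s_{n,k}\Big)-\frac{q^s}{4m^s}\Big[\widehat E\star\Big(\sum_{i=0}^{n-1}\sigma_{n,i}\widehat C^s_i-\gamma^s\delta_v[\widehat f^s\phi_n]_{v_a}^{v_b}\Big)\Big]_k=\tfrac12D^s_n\widehat C^s_{n,k},$$ where a hat denotes the sum of the values at $t^{\tau}$ and $t^{\tau+1}$ (e.g. $\widehat E=E^{\tau+1}+E^{\tau}$). Then the total momentum $P(t)=\sum_{s\in\{e,i\}}m^s\int_0^L\int_{v_a}^{v_b}vf^s(x,v,t)\,dv\,dx$ satisfies $$P(t^{\tau+1})-P(t^{\tau})=\Delta t\sum_{s\in\{e,i\}}\Big(\sigma_1\mathcal{B}^{s;\tau,\tau+1}_{1,0}+\overline\sigma\,\mathcal{B}^{s;\tau,\tau+1}_{0,0}\Big),\qquad \mathcal{B}^{s;\tau,\tau+1}_{n,0}=-\gamma^s\frac{q^s}{4}(v_b-v_a)L\Big[\widehat E\star\delta_v[\widehat f^s\phi_n]_{v_a}^{v_b}\Big]_0 .$$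
   Context: Let $L>0$, $v_a<v_b$, $\Delta t>0$, integers $N_L\ge4$, $N_F\ge0$; species $s\in\{e,i\}$ have mass $m^s>0$ and charge $q^s\in\mathbb{R}$; $\epsilon_0>0$; $\gamma^s\in\mathbb{R}$ is a penalty coefficient and $\nu_s\ge0$ a collision coefficient. Let $L_n$ be the Legendre polynomials on $[-1,1]$ ($L_0=1$, $L_1(\eta)=\eta$, $(2n+1)\eta L_n=(n+1)L_{n+1}+nL_{n-1}$), $\phi_n(v)=\sqrt{2n+1}\,L_n\big((2v-(v_a+v_b))/(v_b-v_a)\big)$, $\psi_k(x)=e^{2\pi i kx/L}$. Constants: $\overline\sigma=\frac{v_a+v_b}{2}$, $\sigma_0=0$, $\sigma_n=\frac{v_b-v_a}{2}\frac{n}{\sqrt{(2n+1)(2n-1)}}$ for $n\ge1$; $\sigma_{n,i}=\pi_{n,i}\frac{2\sqrt{(2n+1)(2i+1)}}{v_b-v_a}$ with $\pi_{n,i}=0$ if $n-i$ is even, $1$ if odd; $D^s_n=-\nu_s\frac{n(n-1)(n-2)}{(N_L-1)(N_L-2)(N_L-3)}$. At each discrete time $t\in\{t^\tau,t^{\tau+1}\}$ (a superscript $\tau$ denotes the value at $t^{\tau}$): $f^s(x,v,t)=\sum_{n=0}^{N_L-1}C^s_n(x,t)\phi_n(v)$, $C^s_n(x,t)=\sum_{k=-N_F}^{N_F}C^s_{n,k}(t)\psi_k(x)$ (real-valued), with conventions $C^s_{-1}=C^s_{N_L}=0$; the electric field $E(x,t)=\sum_{k=-N_F}^{N_F}E_k(t)\psi_k(x)$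 is real-valued, with $E_0=0$ and (Poisson equation) $\epsilon_0\big(\frac{2\pi i}{L}k\big)E_k=(v_b-v_a)\sum_{s\in\{e,i\}}q^sC^s_{0,k}$ for $k\ne0$. For $g(x,v)$, $\delta_v[g]_{v_a}^{v_b}=\frac{g(x,v_b)-g(x,v_a)}{v_b-v_a}$. For trigonometric polynomials $g,h$ of degree at most $N_F$ with Fourier coefficients $g_j,h_j$ (e.g. $h_j=\frac1L\int_0^Lh\,\psi_{-j}\,dx$), $[g\star h]_k=\sum_{k'=-N_F}^{N_F}g_{k'}h_{k-k'}$, with $h_j=0$ for $|j|>N_F$. *)

theory Defs
  imports "HOL-Analysis.Analysis"
begin

datatype species = Electron | Ion

fun legendre :: "nat \<Rightarrow> real \<Rightarrow> real" where
  "legendre 0 \<eta> = 1"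
| "legendre (Suc 0) \<eta> = \<eta>"
| "legendre (Suc (Suc n)) \<eta> =
     ((2 * real n + 3) * \<eta> * legendre (Suc n) \<eta> - (real n + 1) * legendre n \<eta>) / (real n + 2)"

definition phi :: "real \<Rightarrow> real \<Rightarrow> nat \<Rightarrow> real \<Rightarrow> real" where
  "phi va vb n v = sqrt (2 * real n + 1) * legendre n ((2 * v - (va + vb)) / (vb - va))"

definition psi :: "real \<Rightarrow> int \<Rightarrow> real \<Rightarrow> complex" where
  "psi L k x = exp (2 * of_real pi * \<i> * of_int k * of_real x / of_real L)"

definition sigma_bar :: "real \<Rightarrow> real \<Rightarrow> real" where
  "sigma_bar va vb = (va + vb) / 2"

definition sigma_rec :: "real \<Rightarrow> real \<Rightarrow> nat \<Rightarrow> real" where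
  "sigma_rec va vb n =
     (if n = 0 then 0
      else (vb - va) / 2 * (real n / sqrt ((2 * real n + 1) * (2 * real n - 1))))"

definition sigma2 :: "real \<Rightarrow> real \<Rightarrow> nat \<Rightarrow> nat \<Rightarrow> real" where
  "sigma2 va vb n i =
     (if even (int n - int i) then 0 else 1) *
     (2 * sqrt ((2 * real n + 1) * (2 * real i + 1)) / (vb - va))"

definition collision :: "real \<Rightarrow> nat \<Rightarrow> nat \<Rightarrow> real" where
  "collision \<nu> NL n =
     - \<nu> * (real n * (real n - 1) * (real n - 2) /
            ((real NL - 1) * (real NL - 2) * (real NL - 3)))"

definition trig_poly :: "real \<Rightarrow> nat \<Rightarrow> (int \<Rightarrow> complex) \<Rightarrow> real \<Rightarrow> complex" where
  "trig_poly L NF c x = (\<Sum>k\<in>{- int NF..int NF}. c k * psi L k x)"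

text \<open>Legendre coefficients \<open>c\<close> carry a natural index; the integer index here implements the
  convention that the coefficients of index \<open>-1\<close> and \<open>NL\<close> vanish.\<close>

definition coef :: "nat \<Rightarrow> (nat \<Rightarrow> int \<Rightarrow> complex) \<Rightarrow> int \<Rightarrow> int \<Rightarrow> complex" where
  "coef NL c n k = (if 0 \<le> n \<and> n < int NL then c (nat n) k else 0)"

definition distr ::
  "real \<Rightarrow> real \<Rightarrow> real \<Rightarrow> nat \<Rightarrow> nat \<Rightarrow> (nat \<Rightarrow> int \<Rightarrow> complex) \<Rightarrow> real \<Rightarrow> real \<Rightarrow> complex" where
  "distr L va vb NL NF c x v =
     (\<Sum>n<NL. trig_poly L NF (c n) x * of_real (phi va vb n v))"

definition delta_v :: "real \<Rightarrow> real \<Rightarrow> (real \<Rightarrow> real \<Rightarrow> complex) \<Rightarrow> real \<Rightarrow> complex" where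
  "delta_v va vb g x = (g x vb - g x va) / of_real (vb - va)"

definition fourier_coeff :: "real \<Rightarrow> (real \<Rightarrow> complex) \<Rightarrow> int \<Rightarrow> complex" where
  "fourier_coeff L h j = 1 / of_real L * integral {0..L} (\<lambda>x. h x * psi L (- j) x)"

definition star ::
  "real \<Rightarrow> nat \<Rightarrow> (real \<Rightarrow> complex) \<Rightarrow> (real \<Rightarrow> complex) \<Rightarrow> int \<Rightarrow> complex" where
  "star L NF g h k =
     (\<Sum>k'\<in>{- int NF..int NF}. fourier_coeff L g k' *
        (if \<bar>k - k'\<bar> \<le> int NF then fourier_coeff L h (k - k') else 0))"

text \<open>The sum, not the mean, of the two time levels.\<close>

definition hat :: "(real \<Rightarrow> 'a::plus) \<Rightarrow> real \<Rightarrow> real \<Rightarrow> 'a" where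
  "hat u t0 t1 = u t1 + u t0"

definition poisson ::
  "real \<Rightarrow> real \<Rightarrow> real \<Rightarrow> nat \<Rightarrow> real \<Rightarrow> (species \<Rightarrow> real) \<Rightarrow>
   (species \<Rightarrow> nat \<Rightarrow> int \<Rightarrow> complex) \<Rightarrow> (int \<Rightarrow> complex) \<Rightarrow> bool" where
  "poisson L va vb NF \<epsilon> q c e \<longleftrightarrow>
     e 0 = 0 \<and>
     (\<forall>k\<in>{- int NF..int NF}. k \<noteq> 0 \<longrightarrow>
        of_real \<epsilon> * (2 * of_real pi * \<i> / of_real L * of_int k) * e k =
        of_real (vb - va) * (\<Sum>s\<in>{Electron, Ion}. of_real (q s) * c s 0 k))"

text \<open>In the following definitions \<open>c\<close> is the time-dependent family of coefficients of one species
  and \<open>e\<close> that of the electric field.\<close>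

definition boundary_fun ::
  "real \<Rightarrow> real \<Rightarrow> real \<Rightarrow> nat \<Rightarrow> nat \<Rightarrow> real \<Rightarrow> real \<Rightarrow>
   (real \<Rightarrow> nat \<Rightarrow> int \<Rightarrow> complex) \<Rightarrow> nat \<Rightarrow> real \<Rightarrow> complex" where
  "boundary_fun L va vb NL NF t0 t1 c n =
     delta_v va vb (\<lambda>x v. hat (\<lambda>t. distr L va vb NL NF (c t) x v) t0 t1 * of_real (phi va vb n v))"

definition crank_nicolson ::
  "real \<Rightarrow> real \<Rightarrow> real \<Rightarrow> nat \<Rightarrow> nat \<Rightarrow> real \<Rightarrow> real \<Rightarrow> real \<Rightarrow> real \<Rightarrow> real \<Rightarrow> real \<Rightarrow> real \<Rightarrow>
   (real \<Rightarrow> nat \<Rightarrow> int \<Rightarrow> complex) \<Rightarrow> (real \<Rightarrow> int \<Rightarrow> complex) \<Rightarrow> nat \<Rightarrow> int \<Rightarrow> bool" where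
  "crank_nicolson L va vb NL NF \<Delta>t t0 t1 m q \<gamma> \<nu> c e n k \<longleftrightarrow>
     (c t1 n k - c t0 n k) / of_real \<Delta>t
     + of_real pi * \<i> / of_real L * of_int k *
       (of_real (sigma_rec va vb (n + 1)) * hat (\<lambda>t. coef NL (c t) (int n + 1) k) t0 t1
        + of_real (sigma_rec va vb n) * hat (\<lambda>t. coef NL (c t) (int n - 1) k) t0 t1
        + of_real (sigma_bar va vb) * hat (\<lambda>t. coef NL (c t) (int n) k) t0 t1)
     - of_real (q / (4 * m)) *
       star L NF (\<lambda>x. hat (\<lambda>t. trig_poly L NF (e t) x) t0 t1)
         (\<lambda>x. (\<Sum>i<n. of_real (sigma2 va vb n i) * hat (\<lambda>t. trig_poly L NF (c t i) x) t0 t1)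
              - of_real \<gamma> * boundary_fun L va vb NL NF t0 t1 c n x) k
     = 1 / 2 * of_real (collision \<nu> NL n) * hat (\<lambda>t. c t n k) t0 t1"

definition boundary_term ::
  "real \<Rightarrow> real \<Rightarrow> real \<Rightarrow> nat \<Rightarrow> nat \<Rightarrow> real \<Rightarrow> real \<Rightarrow> real \<Rightarrow> real \<Rightarrow>
   (real \<Rightarrow> nat \<Rightarrow> int \<Rightarrow> complex) \<Rightarrow> (real \<Rightarrow> int \<Rightarrow> complex) \<Rightarrow> nat \<Rightarrow> complex" where
  "boundary_term L va vb NL NF t0 t1 q \<gamma> c e n =
     - of_real \<gamma> * of_real (q / 4) * of_real (vb - va) * of_real L *
     star L NF (\<lambda>x. hat (\<lambda>t. trig_poly L NF (e t) x) t0 t1)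
       (boundary_fun L va vb NL NF t0 t1 c n) 0"

definition momentum ::
  "real \<Rightarrow> real \<Rightarrow> real \<Rightarrow> nat \<Rightarrow> nat \<Rightarrow> (species \<Rightarrow> real) \<Rightarrow>
   (species \<Rightarrow> nat \<Rightarrow> int \<Rightarrow> complex) \<Rightarrow> complex" where
  "momentum L va vb NL NF m c =
     (\<Sum>s\<in>{Electron, Ion}. of_real (m s) *
        integral {0..L} (\<lambda>x. integral {va..vb} (\<lambda>v. of_real v * distr L va vb NL NF (c s) x v)))"

end

theory Submission
  imports Defs
begin

text \<open>
  On \<open>[va, vb]\<close> one has \<open>v = \<sigma>\<^sub>1 \<phi>\<^sub>1 + \<sigma>bar \<phi>\<^sub>0\<close>. By the orthogonality of the Legendre
  polynomials and of the exponentials, the momentum of a species is therefore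
  \<open>m (vb - va) L (\<sigma>\<^sub>1 C\<^sub>1\<^sub>,\<^sub>0 + \<sigma>bar C\<^sub>0\<^sub>,\<^sub>0)\<close> (\<open>integral_momentum_density\<close>), and only the zeroth
  Fourier mode of the equations with \<open>n = 0, 1\<close> matters. There the advection and collision terms
  vanish (\<open>crank_nicolson_zero_mode\<close>), which leaves the boundary terms and, for \<open>n = 1\<close>, a
  multiple of \<open>q [E \<star> C\<^sub>0]\<^sub>0\<close>, where \<open>E\<close> and \<open>C\<^sub>0\<close> are summed over the two time levels. After
  multiplication by the mass the remaining factor is the same for both species, so that by the
  Poisson equation these terms add up to zero (\<open>poisson_force_sum_zero\<close>).

  The only part of Legendre orthogonality that is needed is \<open>\<integral> L\<^sub>n = 0\<close> for \<open>n \<ge> 1\<close>. It follows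
  from \<open>(2 n + 1) L\<^sub>n = L'\<^sub>n\<^sub>+\<^sub>1 - L'\<^sub>n\<^sub>-\<^sub>1\<close> and the values \<open>L\<^sub>n (\<plusminus>1) = (\<plusminus>1)\<^sup>n\<close>; the three-term
  recurrence then gives the integrals of \<open>\<eta> L\<^sub>n\<close>.
\<close>

section \<open>Integrals of Legendre polynomials\<close>

text \<open>The derivative of \<open>legendre n\<close>, obtained by differentiating the three-term recurrence.\<close>

fun legendre_deriv :: "nat \<Rightarrow> real \<Rightarrow> real" where
  "legendre_deriv 0 \<eta> = 0"
| "legendre_deriv (Suc 0) \<eta> = 1"
| "legendre_deriv (Suc (Suc n)) \<eta> =
     ((2 * real n + 3) * (legendre (Suc n) \<eta> + \<eta> * legendre_deriv (Suc n) \<eta>)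
       - (real n + 1) * legendre_deriv n \<eta>) / (real n + 2)"

text \<open>The rule \<open>legendre.induct\<close> carries the argument \<open>\<eta>\<close> along as well; it is instantiated with a
  dummy here and below, since only the two-step induction on \<open>n\<close> is wanted.\<close>

lemma DERIV_legendre: "(legendre n has_real_derivative legendre_deriv n x) (at x)"
proof (induction n rule: legendre.induct[of "\<lambda>n _. (legendre n has_real_derivative legendre_deriv n x) (at x)" _ 0])
  case (3 n \<eta>)
  have "((\<lambda>y. ((2 * real n + 3) * y * legendre (Suc n) y - (real n + 1) * legendre n y) / (real n + 2))
    has_real_derivative legendre_deriv (Suc (Suc n)) x) (at x)"
    by (rule derivative_eq_intros 3 refl | simp)+ (simp add: algebra_simps)
  moreover have "legendre (Suc (Suc n)) =
      (\<lambda>y. ((2 * real n + 3) * y * legendre (Suc n) y - (real n + 1) * legendre n y) / (real n + 2))"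
    by (rule ext) simp
  ultimately show ?case by (simp only:)
next
  case (1 \<eta>)
  have "legendre 0 = (\<lambda>_. 1)" by auto
  then show ?case by simp
next
  case (2 \<eta>)
  have "legendre (Suc 0) = (\<lambda>y. y)" by auto
  then show ?case by simp
qed

lemma legendre_three_term:
  "(real n + 2) * legendre (Suc (Suc n)) x =
    (2 * real n + 3) * x * legendre (Suc n) x - (real n + 1) * legendre n x"
  by simp

lemma legendre_deriv_three_term:
  "(real n + 2) * legendre_deriv (Suc (Suc n)) x =
    (2 * real n + 3) * (legendre (Suc n) x + x * legendre_deriv (Suc n) x)
      - (real n + 1) * legendre_deriv n x"
  by simp

text \<open>The two first-order relations are proved together: the first one at \<open>n + 1\<close> needs both at
  \<open>n\<close>, and the second one at \<open>n + 1\<close> needs the first one at \<open>n\<close>.\<close>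

lemma legendre_deriv_relations:
  "x * legendre_deriv (Suc n) x - legendre_deriv n x = (real n + 1) * legendre (Suc n) x \<and>
   legendre_deriv (Suc n) x = x * legendre_deriv n x + (real n + 1) * legendre n x"
proof (induction n)
  case 0
  then show ?case by simp
next
  case (Suc n)
  let ?P = "\<lambda>n. legendre n x" and ?D = "\<lambda>n. legendre_deriv n x"
  have B: "x * ?D (Suc n) = ?D n + (real n + 1) * ?P (Suc n)"
    using conjunct1[OF Suc.IH] by linarith
  have C: "?D (Suc n) = x * ?D n + (real n + 1) * ?P n" using conjunct2[OF Suc.IH] .
  have "(real n + 2) * ?D (Suc (Suc n)) = (real n + 2) * (?D n + (2 * real n + 3) * ?P (Suc n))"
    unfolding legendre_deriv_three_term B by (simp add: algebra_simps)
  then have A: "?D (Suc (Suc n)) = ?D n + (2 * real n + 3) * ?P (Suc n)" by simp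
  have "x * ?D (Suc (Suc n)) - ?D (Suc n)
      = (2 * real n + 3) * x * ?P (Suc n) - (real n + 1) * ?P n"
    unfolding A C by (simp add: algebra_simps)
  also have "\<dots> = (real n + 2) * ?P (Suc (Suc n))" by (simp only: legendre_three_term)
  finally have "x * ?D (Suc (Suc n)) - ?D (Suc n) = (real n + 2) * ?P (Suc (Suc n))" .
  moreover have "?D (Suc (Suc n)) = x * ?D (Suc n) + (real n + 2) * ?P (Suc n)"
    unfolding A B by (simp add: algebra_simps)
  ultimately show ?case by (simp only: of_nat_Suc) (simp add: add_ac)
qed

lemma legendre_deriv_diff:
  "legendre_deriv (Suc (Suc n)) x - legendre_deriv n x = (2 * real n + 3) * legendre (Suc n) x"
proof -
  have "x * legendre_deriv (Suc n) x = legendre_deriv n x + (real n + 1) * legendre (Suc n) x"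
    using conjunct1[OF legendre_deriv_relations[of x n]] by linarith
  then show ?thesis
    unfolding conjunct2[OF legendre_deriv_relations[of x "Suc n"]] by (simp add: algebra_simps)
qed

lemma legendre_1: "legendre n 1 = 1"
  by (induction n rule: legendre.induct[of "\<lambda>n _. legendre n 1 = 1" _ 0]) (auto simp: field_simps)

lemma legendre_minus_1: "legendre n (- 1) = (- 1) ^ n"
  by (induction n rule: legendre.induct[of "\<lambda>n _. legendre n (- 1) = (- 1) ^ n" _ 0])
     (auto simp: field_simps)

text \<open>An antiderivative of \<open>L\<^sub>n\<close>, \<open>n \<ge> 1\<close>, is \<open>(L\<^sub>n\<^sub>+\<^sub>1 - L\<^sub>n\<^sub>-\<^sub>1) / (2 n + 1)\<close>, which vanishes at
  both end points because \<open>n + 1\<close> and \<open>n - 1\<close> have the same parity.\<close>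

lemma has_integral_legendre:
  assumes "va < vb"
  shows "((\<lambda>v. legendre n ((2 * v - (va + vb)) / (vb - va))) has_integral
           (if n = 0 then vb - va else 0)) {va..vb}"
proof (cases n)
  case 0
  then show ?thesis using assms has_integral_const_real[of "1::real" va vb] by simp
next
  case (Suc j)
  define \<eta> where "\<eta> v = (2 * v - (va + vb)) / (vb - va)" for v
  define F where "F v = (vb - va) / 2 * ((legendre (Suc (Suc j)) (\<eta> v) - legendre j (\<eta> v)) / (2 * real j + 3))" for v
  have d\<eta>: "(\<eta> has_real_derivative 2 / (vb - va)) (at v)" for v
    unfolding \<eta>_def by (intro DERIV_cdivide) (auto intro!: derivative_eq_intros)
  have dL: "((\<lambda>v. legendre i (\<eta> v)) has_real_derivative legendre_deriv i (\<eta> v) * (2 / (vb - va))) (at v)" for i v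
    by (rule DERIV_chain2[OF DERIV_legendre d\<eta>])
  have "(F has_real_derivative
      (vb - va) / 2 * ((legendre_deriv (Suc (Suc j)) (\<eta> v) * (2 / (vb - va))
        - legendre_deriv j (\<eta> v) * (2 / (vb - va))) / (2 * real j + 3))) (at v)" for v
    unfolding F_def by (intro DERIV_cmult DERIV_cdivide DERIV_diff dL)
  moreover have "(vb - va) / 2 * ((legendre_deriv (Suc (Suc j)) (\<eta> v) * (2 / (vb - va))
        - legendre_deriv j (\<eta> v) * (2 / (vb - va))) / (2 * real j + 3)) = legendre (Suc j) (\<eta> v)" for v
  proof -
    have "(vb - va) / 2 * ((a * (2 / (vb - va)) - b * (2 / (vb - va))) / c) = (a - b) / c" for a b c
      using assms by (subst left_diff_distrib[symmetric]) (simp del: left_diff_distrib_numeral)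
    note scale = this
    show ?thesis unfolding scale legendre_deriv_diff by (simp del: legendre.simps)
  qed
  ultimately have dF: "(F has_real_derivative legendre (Suc j) (\<eta> v)) (at v)" for v by metis
  have "((\<lambda>v. legendre (Suc j) (\<eta> v)) has_integral (F vb - F va)) {va..vb}"
    by (rule fundamental_theorem_of_calculus)
       (use assms dF in \<open>auto simp flip: has_real_derivative_iff_has_vector_derivative
          intro: has_field_derivative_at_within\<close>)
  moreover have "\<eta> vb = 1" "\<eta> va = - 1"
    using assms by (auto simp: \<eta>_def field_simps)
  then have "F vb = 0" "F va = 0"
    by (simp_all add: F_def legendre_1 legendre_minus_1 del: legendre.simps)
  ultimately show ?thesis using Suc by (simp add: \<eta>_def)
qed

text \<open>By the recurrence, \<open>\<eta> L\<^sub>n\<close> is a combination of \<open>L\<^sub>n\<^sub>+\<^sub>1\<close> and \<open>L\<^sub>n\<^sub>-\<^sub>1\<close>, and only \<open>L\<^sub>0\<close>, which occurs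
  just for \<open>n = 1\<close>, has a nonzero integral.\<close>

lemma has_integral_velocity_phi:
  assumes "va < vb"
  shows "((\<lambda>v. v * phi va vb n v) has_integral
     (if n = 0 then (vb - va) * sigma_bar va vb
      else if n = 1 then (vb - va) * sigma_rec va vb 1 else 0)) {va..vb}"
proof -
  define \<eta> where "\<eta> v = (2 * v - (va + vb)) / (vb - va)" for v
  have v: "v = (vb - va) / 2 * \<eta> v + sigma_bar va vb" for v
    using assms by (simp add: \<eta>_def sigma_bar_def field_simps)
  have I: "((\<lambda>v. legendre i (\<eta> v)) has_integral (if i = 0 then vb - va else 0)) {va..vb}" for i
    using has_integral_legendre[OF assms, of i] by (simp add: \<eta>_def)
  show ?thesis
  proof (cases n)
    case 0
    have "v * phi va vb 0 v = (vb - va) / 2 * legendre 1 (\<eta> v) + sigma_bar va vb * legendre 0 (\<eta> v)" for v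
      using v[of v] by (simp add: phi_def)
    moreover have "((\<lambda>v. (vb - va) / 2 * legendre 1 (\<eta> v) + sigma_bar va vb * legendre 0 (\<eta> v))
        has_integral (vb - va) / 2 * (if 1 = (0::nat) then vb - va else 0)
          + sigma_bar va vb * (if 0 = (0::nat) then vb - va else 0)) {va..vb}"
      by (intro has_integral_add has_integral_mult_right I)
    ultimately show ?thesis using 0 by (simp add: mult.commute)
  next
    case (Suc j)
    define S where "S = sqrt (2 * real j + 3)"
    define K where "K = (vb - va) / 2 / (2 * real j + 3)"
    let ?f = "\<lambda>v. S * (K * ((real j + 2) * legendre (Suc (Suc j)) (\<eta> v) + (real j + 1) * legendre j (\<eta> v))
          + sigma_bar va vb * legendre (Suc j) (\<eta> v))"
    have "v * phi va vb n v = ?f v" for v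
    proof -
      have "2 * real j + 3 \<noteq> 0" by linarith
      then have K: "K * (2 * real j + 3) = (vb - va) / 2"
        using K_def nonzero_eq_divide_eq by blast
      have "?f v = S * (K * (2 * real j + 3) * \<eta> v * legendre (Suc j) (\<eta> v)
          + sigma_bar va vb * legendre (Suc j) (\<eta> v))"
        unfolding legendre_three_term by (simp add: algebra_simps)
      also have "\<dots> = ((vb - va) / 2 * \<eta> v + sigma_bar va vb) * (S * legendre (Suc j) (\<eta> v))"
        unfolding K by (simp add: algebra_simps)
      also have "\<dots> = v * (S * legendre (Suc j) (\<eta> v))"
        by (simp only: v[symmetric])
      also have "\<dots> = v * phi va vb n v"
        by (simp add: phi_def Suc S_def \<eta>_def algebra_simps)
      finally show ?thesis by simp
    qed
    moreover have "(?f has_integral S * (K * ((real j + 2) * (if Suc (Suc j) = 0 then vb - va else 0)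
          + (real j + 1) * (if j = 0 then vb - va else 0))
          + sigma_bar va vb * (if Suc j = 0 then vb - va else 0))) {va..vb}"
      by (intro has_integral_add has_integral_mult_right I)
    moreover have "S * (K * ((real j + 2) * (if Suc (Suc j) = 0 then vb - va else 0)
          + (real j + 1) * (if j = 0 then vb - va else 0))
          + sigma_bar va vb * (if Suc j = 0 then vb - va else 0))
        = (if j = 0 then (vb - va) * sigma_rec va vb 1 else 0)"
    proof (cases j)
      case 0
      have s3: "1 / sqrt 3 = sqrt (3::real) / 3" by (simp add: field_simps)
      have "sigma_rec va vb 1 = (vb - va) / 2 * (1 / sqrt 3)" by (simp add: sigma_rec_def)
      then have "sigma_rec va vb 1 = (vb - va) / 2 * (sqrt 3 / 3)" unfolding s3 .
      then show ?thesis using 0 by (simp add: S_def K_def)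
    qed simp
    ultimately show ?thesis
      using Suc by simp
  qed
qed

section \<open>Fourier coefficients of trigonometric polynomials\<close>

lemma continuous_on_psi [continuous_intros]: "continuous_on A (psi L k)"
  unfolding psi_def divide_inverse by (intro continuous_intros)

lemma continuous_on_trig_poly [continuous_intros]: "continuous_on A (trig_poly L NF c)"
  unfolding trig_poly_def by (intro continuous_intros)

lemma psi_mult: "psi L k x * psi L j x = psi L (k + j) x"
  unfolding psi_def by (simp add: mult_exp_exp ring_distribs add_divide_distrib)

lemma psi_period:
  assumes "L > 0"
  shows "psi L k L = 1"
proof -
  have "psi L k L = exp (2 * of_real pi * \<i> * of_int k)"
    using assms by (simp add: psi_def)
  also have "\<dots> = 1"
    using exp_integer_2pi[of "of_int k"] by (simp add: mult_ac)
  finally show ?thesis .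
qed

lemma has_integral_psi:
  assumes "L > 0"
  shows "(psi L k has_integral (if k = 0 then of_real L else 0)) {0..L}"
proof (cases "k = 0")
  case True
  have "psi L k = (\<lambda>x. 1)" by (auto simp: psi_def True)
  then show ?thesis
    using True assms has_integral_const_real[of "1::complex" 0 L] by (simp add: scaleR_conv_of_real)
next
  case False
  define a where "a = 2 * of_real pi * \<i> * of_int k / (of_real L :: complex)"
  have a: "a \<noteq> 0" using False assms by (simp add: a_def)
  have psi: "psi L k x = exp (a * of_real x)" for x
    by (simp add: psi_def a_def)
  have "((\<lambda>x. exp (a * of_real x) / a) has_vector_derivative exp (a * of_real x)) (at x within {0..L})" for x
  proof -
    have "((\<lambda>z. exp (a * z) / a) has_field_derivative exp (a * of_real x)) (at (of_real x))"
      by (rule derivative_eq_intros refl | simp add: a)+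
    then show ?thesis
      by (rule has_vector_derivative_real_field)
  qed
  then have "((\<lambda>x. exp (a * of_real x)) has_integral
      (exp (a * of_real L) / a - exp (a * of_real 0) / a)) {0..L}"
    using assms by (intro fundamental_theorem_of_calculus) auto
  then show ?thesis
    using False psi_period[OF assms, of k] by (simp add: psi[abs_def] psi)
qed

lemma fourier_coeff_trig_poly:
  assumes "L > 0" "\<bar>j\<bar> \<le> int NF"
  shows "fourier_coeff L (trig_poly L NF c) j = c j"
proof -
  have "((\<lambda>x. \<Sum>k\<in>{- int NF..int NF}. c k * psi L (k - j) x) has_integral
      (\<Sum>k\<in>{- int NF..int NF}. c k * (if k - j = 0 then of_real L else 0))) {0..L}"
    by (intro has_integral_sum has_integral_mult_right has_integral_psi assms) auto
  also have "(\<Sum>k\<in>{- int NF..int NF}. c k * (if k - j = 0 then of_real L else 0))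
      = (\<Sum>k\<in>{- int NF..int NF}. if k = j then c j * of_real L else 0)"
    by (intro sum.cong) auto
  also have "\<dots> = c j * of_real L"
    using assms by (simp add: abs_le_iff)
  also have "(\<lambda>x. \<Sum>k\<in>{- int NF..int NF}. c k * psi L (k - j) x)
      = (\<lambda>x. trig_poly L NF c x * psi L (- j) x)"
    by (simp add: trig_poly_def sum_distrib_right mult.assoc psi_mult)
  finally show ?thesis
    using assms by (simp add: fourier_coeff_def integral_unique)
qed

lemma fourier_coeff_diff_scaled:
  assumes "continuous_on {0..L} h" "continuous_on {0..L} b"
  shows "fourier_coeff L (\<lambda>x. h x - a * b x) j = fourier_coeff L h j - a * fourier_coeff L b j"
proof -
  have h: "(\<lambda>x. h x * psi L (- j) x) integrable_on {0..L}"
    and b: "(\<lambda>x. b x * psi L (- j) x) integrable_on {0..L}"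
    by (intro integrable_continuous_real continuous_intros assms)+
  have "integral {0..L} (\<lambda>x. (h x - a * b x) * psi L (- j) x)
      = integral {0..L} (\<lambda>x. h x * psi L (- j) x - a * (b x * psi L (- j) x))"
    by (simp add: algebra_simps)
  also have "\<dots> = integral {0..L} (\<lambda>x. h x * psi L (- j) x) - a * integral {0..L} (\<lambda>x. b x * psi L (- j) x)"
    using h b by (simp add: integral_diff integrable_on_mult_right)
  finally show ?thesis
    unfolding fourier_coeff_def by (simp only: right_diff_distrib mult.left_commute)
qed

lemma star_diff_scaled:
  assumes "continuous_on {0..L} h" "continuous_on {0..L} b"
  shows "star L NF g (\<lambda>x. h x - a * b x) k = star L NF g h k - a * star L NF g b k"
  unfolding star_def fourier_coeff_diff_scaled[OF assms] sum_distrib_left sum_subtractf[symmetric]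
  by (intro sum.cong) (auto simp: algebra_simps)

lemma star_trig_poly_0:
  assumes "L > 0"
  shows "star L NF (trig_poly L NF a) (trig_poly L NF b) 0 = (\<Sum>k\<in>{- int NF..int NF}. a k * b (- k))"
  unfolding star_def by (intro sum.cong) (auto simp: fourier_coeff_trig_poly assms abs_le_iff)

lemma trig_poly_add: "trig_poly L NF a x + trig_poly L NF b x = trig_poly L NF (\<lambda>k. a k + b k) x"
  by (simp add: trig_poly_def ring_distribs sum.distrib)

lemma trig_poly_mult: "z * trig_poly L NF a x = trig_poly L NF (\<lambda>k. z * a k) x"
  by (simp add: trig_poly_def sum_distrib_left mult.assoc)

section \<open>The momentum balance\<close>

lemma continuous_on_boundary_fun: "continuous_on A (boundary_fun L va vb NL NF t0 t1 c n)"
  unfolding boundary_fun_def delta_v_def hat_def distr_def divide_inverse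
  by (intro continuous_intros)

lemma integral_momentum_density:
  assumes "L > 0" "va < vb" "2 \<le> NL"
  shows "integral {0..L} (\<lambda>x. integral {va..vb} (\<lambda>v. of_real v * distr L va vb NL NF c x v))
    = of_real ((vb - va) * L) * (of_real (sigma_rec va vb 1) * c 1 0 + of_real (sigma_bar va vb) * c 0 0)"
proof -
  let ?T = "\<lambda>n. trig_poly L NF (c n)"
  let ?J = "\<lambda>n. if n = 0 then (vb - va) * sigma_bar va vb
      else if n = 1 then (vb - va) * sigma_rec va vb 1 else 0"
  have inner: "integral {va..vb} (\<lambda>v. of_real v * distr L va vb NL NF c x v)
      = of_real (vb - va) * (of_real (sigma_bar va vb) * ?T 0 x + of_real (sigma_rec va vb 1) * ?T 1 x)" for x
  proof -
    have "((\<lambda>v. \<Sum>n<NL. ?T n x * of_real (v * phi va vb n v)) has_integral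
        (\<Sum>n<NL. ?T n x * of_real (?J n))) {va..vb}"
      by (intro has_integral_sum has_integral_mult_right has_integral_of_real
          has_integral_velocity_phi assms) auto
    also have "(\<lambda>v. \<Sum>n<NL. ?T n x * of_real (v * phi va vb n v))
        = (\<lambda>v. of_real v * distr L va vb NL NF c x v)"
      by (simp add: distr_def sum_distrib_left mult_ac)
    also have "(\<Sum>n<NL. ?T n x * of_real (?J n)) = (\<Sum>n\<in>{0, 1}. ?T n x * of_real (?J n))"
      using assms by (intro sum.mono_neutral_right) auto
    also have "\<dots> = of_real (vb - va) * (of_real (sigma_bar va vb) * ?T 0 x + of_real (sigma_rec va vb 1) * ?T 1 x)"
      by (simp add: algebra_simps)
    finally show ?thesis by (rule integral_unique)
  qed
  have T: "integral {0..L} (?T n) = of_real L * c n 0" for n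
    using fourier_coeff_trig_poly[OF assms(1), of 0 NF "c n"] assms
    by (simp add: fourier_coeff_def psi_def field_simps)
  have "?T n integrable_on {0..L}" for n
    by (intro integrable_continuous_real continuous_intros)
  then have T': "(?T n has_integral of_real L * c n 0) {0..L}" for n
    unfolding T[symmetric] by (rule integrable_integral)
  have "((\<lambda>x. of_real (vb - va) * (of_real (sigma_bar va vb) * ?T 0 x + of_real (sigma_rec va vb 1) * ?T 1 x))
      has_integral of_real (vb - va) * (of_real (sigma_bar va vb) * (of_real L * c 0 0)
        + of_real (sigma_rec va vb 1) * (of_real L * c 1 0))) {0..L}"
    by (intro has_integral_mult_right has_integral_add T')
  then show ?thesis
    unfolding inner by (simp add: integral_unique algebra_simps)
qed

text \<open>In the zeroth Fourier mode the advection terms drop out, and for \<open>n = 0, 1\<close> so does the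
  collision term.\<close>

lemma crank_nicolson_zero_mode:
  assumes "crank_nicolson L va vb NL NF \<Delta>t t0 t1 m q \<gamma> \<nu> c e n 0" "n \<le> 1" "L > 0" "\<Delta>t > 0"
  shows "c t1 n 0 - c t0 n 0 = of_real \<Delta>t * of_real (q / (4 * m)) *
     ((if n = 1 then of_real (sigma2 va vb 1 0) *
         (\<Sum>k\<in>{- int NF..int NF}. (e t1 k + e t0 k) * (c t1 0 (- k) + c t0 0 (- k))) else 0)
      - of_real \<gamma> * star L NF (\<lambda>x. hat (\<lambda>t. trig_poly L NF (e t) x) t0 t1)
          (boundary_fun L va vb NL NF t0 t1 c n) 0)"
proof -
  let ?E = "\<lambda>x. hat (\<lambda>t. trig_poly L NF (e t) x) t0 t1"
  let ?b = "boundary_fun L va vb NL NF t0 t1 c n"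
  \<comment> \<open>The sum over \<open>i < n\<close> is empty for \<open>n = 0\<close> and has the single term \<open>i = 0\<close> for \<open>n = 1\<close>.\<close>
  define d where "d k = (if n = 1 then of_real (sigma2 va vb 1 0) * (c t1 0 k + c t0 0 k) else 0)" for k
  have D: "collision \<nu> NL n = 0" using assms(2) by (cases n) (auto simp: collision_def)
  have E: "?E = trig_poly L NF (\<lambda>k. e t1 k + e t0 k)"
    by (simp add: hat_def trig_poly_add)
  have "(\<lambda>x. (\<Sum>i<n. of_real (sigma2 va vb n i) * hat (\<lambda>t. trig_poly L NF (c t i) x) t0 t1))
      = trig_poly L NF d"
    using assms(2)
    by (cases n) (auto simp: fun_eq_iff d_def[abs_def] hat_def trig_poly_add trig_poly_mult trig_poly_def[of L NF "\<lambda>_. 0"])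
  then have "star L NF ?E (\<lambda>x. (\<Sum>i<n. of_real (sigma2 va vb n i) * hat (\<lambda>t. trig_poly L NF (c t i) x) t0 t1)
              - of_real \<gamma> * ?b x) 0 = star L NF ?E (\<lambda>x. trig_poly L NF d x - of_real \<gamma> * ?b x) 0"
    by (simp add: fun_eq_iff)
  also have "\<dots> = star L NF ?E (trig_poly L NF d) 0 - of_real \<gamma> * star L NF ?E ?b 0"
    by (intro star_diff_scaled continuous_intros continuous_on_boundary_fun)
  also have "star L NF ?E (trig_poly L NF d) 0 = (\<Sum>k\<in>{- int NF..int NF}. (e t1 k + e t0 k) * d (- k))"
    unfolding E by (rule star_trig_poly_0[OF assms(3)])
  also have "\<dots> = (if n = 1 then of_real (sigma2 va vb 1 0) *
         (\<Sum>k\<in>{- int NF..int NF}. (e t1 k + e t0 k) * (c t1 0 (- k) + c t0 0 (- k))) else 0)"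
    by (simp add: d_def sum_distrib_left mult_ac)
  finally have S: "star L NF ?E (\<lambda>x. (\<Sum>i<n. of_real (sigma2 va vb n i) * hat (\<lambda>t. trig_poly L NF (c t i) x) t0 t1)
              - of_real \<gamma> * ?b x) 0 = \<dots> - of_real \<gamma> * star L NF ?E ?b 0" .
  have solve: "x = of_real \<Delta>t * w * y" if "x / of_real \<Delta>t - w * y = 0" for x y w :: complex
    using that assms(4) by (simp add: field_simps)
  show ?thesis
    using assms(1) unfolding crank_nicolson_def S D
    by (intro solve) simp
qed

text \<open>The electric field exerts no net force: by the Poisson equation, the charge density in each
  mode \<open>k \<noteq> 0\<close> is a fixed multiple of \<open>k E\<^sub>k\<close>, and \<open>\<Sum>\<^sub>k k E\<^sub>k E\<^sub>-\<^sub>k\<close> is its own negative under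
  \<open>k \<mapsto> -k\<close>. The Poisson equation is linear, hence passes to the sum of the two time levels. It says
  nothing about the total charge (\<open>k = 0\<close>), but there \<open>E\<^sub>0 = 0\<close>.\<close>

lemma poisson_force_sum_zero:
  assumes "va < vb" "poisson L va vb NF \<epsilon> q (\<lambda>s. c s r0) (e r0)"
    "poisson L va vb NF \<epsilon> q (\<lambda>s. c s r1) (e r1)"
  shows "(\<Sum>s\<in>{Electron, Ion}. of_real (q s) *
      (\<Sum>k\<in>{- int NF..int NF}. (e r1 k + e r0 k) * (c s r1 0 (- k) + c s r0 0 (- k)))) = 0"
proof -
  define h where "h k = e r1 k + e r0 k" for k
  define g where "g s k = c s r1 0 k + c s r0 0 k" for s k
  define z where "z = of_real \<epsilon> * (2 * of_real pi * \<i> / of_real L) / (of_real (vb - va) :: complex)"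
  let ?I = "{- int NF..int NF}"
  have h0: "h 0 = 0" using assms by (simp add: h_def poisson_def)
  have charge: "(\<Sum>s\<in>{Electron, Ion}. of_real (q s) * g s k) = z * of_int k * h k" if "k \<in> ?I" "k \<noteq> 0" for k
  proof -
    have p: "of_real \<epsilon> * (2 * of_real pi * \<i> / of_real L * of_int k) * e r k =
        of_real (vb - va) * (\<Sum>s\<in>{Electron, Ion}. of_real (q s) * c s r 0 k)" if "r \<in> {r0, r1}" for r
      using assms(2,3) \<open>k \<in> ?I\<close> \<open>k \<noteq> 0\<close> that unfolding poisson_def by auto
    have solve: "y = a / w" if "a = w * y" "w \<noteq> 0" for a w y :: complex
      using that by simp
    have "of_real \<epsilon> * (2 * of_real pi * \<i> / of_real L * of_int k) * h k
        = of_real (vb - va) * (\<Sum>s\<in>{Electron, Ion}. of_real (q s) * g s k)"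
      using p[of r0] p[of r1] unfolding h_def g_def
      by (simp only: distrib_left sum.distrib insert_iff simp_thms)
    moreover have "of_real (vb - va) \<noteq> (0::complex)" using assms(1) by (simp only: of_real_eq_0_iff)
    ultimately have "(\<Sum>s\<in>{Electron, Ion}. of_real (q s) * g s k)
        = of_real \<epsilon> * (2 * of_real pi * \<i> / of_real L * of_int k) * h k / of_real (vb - va)"
      by (rule solve)
    also have "\<dots> = z * of_int k * h k"
      by (simp add: z_def mult_ac del: of_real_diff)
    finally show ?thesis .
  qed
  define S where "S = (\<Sum>k\<in>?I. of_int k * h k * h (- k))"
  have "S = (\<Sum>k\<in>?I. of_int (- k) * h (- k) * h (- (- k)))"
    unfolding S_def by (rule sum.reindex_bij_witness[where i = uminus and j = uminus]) auto
  also have "\<dots> = - S" by (simp add: S_def sum_negf mult_ac)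
  finally have S: "S = 0" by simp
  have "(\<Sum>s\<in>{Electron, Ion}. of_real (q s) * (\<Sum>k\<in>?I. h k * g s (- k)))
      = (\<Sum>k\<in>?I. h k * (\<Sum>s\<in>{Electron, Ion}. of_real (q s) * g s (- k)))"
    by (simp add: sum_distrib_left sum.distrib ring_distribs mult_ac)
  also have "\<dots> = (\<Sum>k\<in>?I. - z * (of_int k * h k * h (- k)))"
  proof (intro sum.cong refl)
    fix k assume k: "k \<in> ?I"
    show "h k * (\<Sum>s\<in>{Electron, Ion}. of_real (q s) * g s (- k)) = - z * (of_int k * h k * h (- k))"
    proof (cases "k = 0")
      case False
      then show ?thesis using k charge[of "- k"] by (subst charge) (auto simp: mult_ac)
    qed (simp add: h0)
  qed
  also have "\<dots> = - z * S" by (simp only: S_def sum_distrib_left)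
  finally show ?thesis by (simp add: S h_def g_def)
qed

theorem mainTheorem8:
  fixes L va vb \<Delta>t \<epsilon>\<^sub>0 :: real
    and NL NF :: nat
    and m q \<gamma> \<nu> :: "species \<Rightarrow> real"
    and t :: "nat \<Rightarrow> real" and \<tau> :: nat
    and C :: "species \<Rightarrow> real \<Rightarrow> nat \<Rightarrow> int \<Rightarrow> complex"
    and E :: "real \<Rightarrow> int \<Rightarrow> complex"
  assumes "L > 0" and "va < vb" and "\<Delta>t > 0" and "NL \<ge> 4" and "\<epsilon>\<^sub>0 > 0"
    and "\<And>s. m s > 0" and "\<And>s. \<nu> s \<ge> 0"
    and step: "t (\<tau> + 1) = t \<tau> + \<Delta>t"
    and C_real: "\<And>r s n x. r \<in> {t \<tau>, t (\<tau> + 1)} \<Longrightarrow> n < NL \<Longrightarrow> trig_poly L NF (C s r n) x \<in> \<real>"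
    and E_real: "\<And>r x. r \<in> {t \<tau>, t (\<tau> + 1)} \<Longrightarrow> trig_poly L NF (E r) x \<in> \<real>"
    and poisson: "\<And>r. r \<in> {t \<tau>, t (\<tau> + 1)} \<Longrightarrow>
      poisson L va vb NF \<epsilon>\<^sub>0 q (\<lambda>s. C s r) (E r)"
    and scheme: "\<And>s n k. n \<le> NL - 1 \<Longrightarrow> - int NF \<le> k \<Longrightarrow> k \<le> int NF \<Longrightarrow>
      crank_nicolson L va vb NL NF \<Delta>t (t \<tau>) (t (\<tau> + 1)) (m s) (q s) (\<gamma> s) (\<nu> s) (C s) E n k"
  shows "momentum L va vb NL NF m (\<lambda>s. C s (t (\<tau> + 1))) - momentum L va vb NL NF m (\<lambda>s. C s (t \<tau>))
    = of_real \<Delta>t * (\<Sum>s\<in>{Electron, Ion}.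
        of_real (sigma_rec va vb 1)
          * boundary_term L va vb NL NF (t \<tau>) (t (\<tau> + 1)) (q s) (\<gamma> s) (C s) E 1
        + of_real (sigma_bar va vb)
          * boundary_term L va vb NL NF (t \<tau>) (t (\<tau> + 1)) (q s) (\<gamma> s) (C s) E 0)"
proof -
  let ?t0 = "t \<tau>" and ?t1 = "t (\<tau> + 1)"
  let ?B = "\<lambda>s n. boundary_term L va vb NL NF ?t0 ?t1 (q s) (\<gamma> s) (C s) E n"
  let ?s1 = "complex_of_real (sigma_rec va vb 1)" and ?s0 = "complex_of_real (sigma_bar va vb)"
  let ?V = "complex_of_real ((vb - va) * L)"
  define W where "W s n = star L NF (\<lambda>x. hat (\<lambda>r. trig_poly L NF (E r) x) ?t0 ?t1)
      (boundary_fun L va vb NL NF ?t0 ?t1 (C s) n) 0" for s n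
  define Q where "Q s = (\<Sum>k\<in>{- int NF..int NF}. (E ?t1 k + E ?t0 k) * (C s ?t1 0 (- k) + C s ?t0 0 (- k)))" for s
  \<comment> \<open>The factor of the electric force that remains after multiplication by the mass; it does not
    depend on the species.\<close>
  define \<kappa> where "\<kappa> = complex_of_real \<Delta>t * ?V / 4 * ?s1 * of_real (sigma2 va vb 1 0)"
  have B: "?B s n = - of_real (\<gamma> s) * of_real (q s / 4) * ?V * W s n" for s n
    by (simp add: boundary_term_def W_def)
  have NL: "2 \<le> NL" using assms(4) by simp
  have mq: "complex_of_real (m s) * of_real (q s / (4 * m s)) = of_real (q s / 4)" for s
    unfolding of_real_mult[symmetric] using assms(6)[of s] by simp
  have c0: "C s ?t1 0 0 - C s ?t0 0 0 = of_real \<Delta>t * of_real (q s / (4 * m s)) * (- of_real (\<gamma> s) * W s 0)" for s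
    using crank_nicolson_zero_mode[OF scheme[of 0 0 s]] assms(1,3) by (simp add: W_def)
  have c1: "C s ?t1 1 0 - C s ?t0 1 0 = of_real \<Delta>t * of_real (q s / (4 * m s))
      * (of_real (sigma2 va vb 1 0) * Q s - of_real (\<gamma> s) * W s 1)" for s
    using crank_nicolson_zero_mode[OF scheme[of 1 0 s]] assms(1,3,4) by (simp add: W_def Q_def)
  have species: "of_real (m s) * (?V * (?s1 * C s ?t1 1 0 + ?s0 * C s ?t1 0 0))
      - of_real (m s) * (?V * (?s1 * C s ?t0 1 0 + ?s0 * C s ?t0 0 0))
      = of_real \<Delta>t * (?s1 * ?B s 1 + ?s0 * ?B s 0) + \<kappa> * (of_real (q s) * Q s)" for s
  proof -
    have "of_real (m s) * (?V * (?s1 * C s ?t1 1 0 + ?s0 * C s ?t1 0 0))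
      - of_real (m s) * (?V * (?s1 * C s ?t0 1 0 + ?s0 * C s ?t0 0 0))
      = of_real (m s) * ?V * (?s1 * (C s ?t1 1 0 - C s ?t0 1 0) + ?s0 * (C s ?t1 0 0 - C s ?t0 0 0))"
      by (simp add: algebra_simps del: of_real_mult of_real_diff)
    also have "\<dots> = (of_real (m s) * of_real (q s / (4 * m s))) * of_real \<Delta>t * ?V *
        (?s1 * (of_real (sigma2 va vb 1 0) * Q s - of_real (\<gamma> s) * W s 1) + ?s0 * (- of_real (\<gamma> s) * W s 0))"
      unfolding c0 c1 by (simp only: ring_distribs mult_ac)
    also have "\<dots> = of_real \<Delta>t * (?s1 * ?B s 1 + ?s0 * ?B s 0) + \<kappa> * (of_real (q s) * Q s)"
      unfolding B mq \<kappa>_def by (simp add: algebra_simps del: of_real_mult of_real_diff)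
    finally show ?thesis .
  qed
  have "momentum L va vb NL NF m (\<lambda>s. C s ?t1) - momentum L va vb NL NF m (\<lambda>s. C s ?t0)
      = (\<Sum>s\<in>{Electron, Ion}. of_real (m s) * (?V * (?s1 * C s ?t1 1 0 + ?s0 * C s ?t1 0 0))
          - of_real (m s) * (?V * (?s1 * C s ?t0 1 0 + ?s0 * C s ?t0 0 0)))"
    unfolding momentum_def integral_momentum_density[OF assms(1,2) NL] by (simp only: sum_subtractf)
  also have "\<dots> = of_real \<Delta>t * (\<Sum>s\<in>{Electron, Ion}. ?s1 * ?B s 1 + ?s0 * ?B s 0)
      + \<kappa> * (\<Sum>s\<in>{Electron, Ion}. of_real (q s) * Q s)"
    unfolding species by (simp add: distrib_left add_ac)
  also have "(\<Sum>s\<in>{Electron, Ion}. of_real (q s) * Q s) = 0"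
    unfolding Q_def using assms(2) poisson by (intro poisson_force_sum_zero) auto
  finally show ?thesis by simp
qed

end
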